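(* Each Baire periodic paratopological group is a topological group.
   Context: A paratopological group is a group with a topology such that the multiplication is continuous; it is a topological group if moreover inversion is continuous. A group is periodic if each of its elements has finite order. A space is Baire if every countable intersection of dense open subsets is dense. No separation axioms are assumed. *)

theory Defs
  imports "HOL-Analysis.Analysis" "HOL-Algebra.Multiplicative_Group"
begin

text \<open>
  The group is an object of HOL-Algebra and the topology is an abstract topology whose
  underlying set is the carrier; this keeps the notions free of separation axioms.
\<close>

locale paratopological_group = group G for G (structure) +
  fixes T :: "'a topology"
  assumes topspace_eq_carrier: "topspace T = carrier G"
    and continuous_mult: "continuous_map (prod_topology T T) T (\<lambda>(x, y). x \<otimes> y)"

locale topological_group = paratopological_group +
  assumes continuous_inv: "continuous_map T T (\<lambda>x. inv x)"

definition periodic_group :: "('a, 'b) monoid_scheme \<Rightarrow> bool" where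
  "periodic_group G \<longleftrightarrow> group G \<and> (\<forall>x \<in> carrier G. \<exists>n::nat. 0 < n \<and> x [^]\<^bsub>G\<^esub> n = \<one>\<^bsub>G\<^esub>)"

definition dense_in :: "'a topology \<Rightarrow> 'a set \<Rightarrow> bool" where
  "dense_in T S \<longleftrightarrow> S \<subseteq> topspace T \<and> T closure_of S = topspace T"

text \<open>
  The intersection is taken inside the space, so that the empty family causes no problem
  when the space is not the whole type.
\<close>

definition Baire_space :: "'a topology \<Rightarrow> bool" where
  "Baire_space T \<longleftrightarrow>
    (\<forall>\<U>. countable \<U> \<and> (\<forall>U \<in> \<U>. openin T U \<and> dense_in T U)
      \<longrightarrow> dense_in T (topspace T \<inter> \<Inter>\<U>))"

end

theory Submission
  imports Defs
begin

text \<open>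
  By Baire, for some \<open>n > 0\<close> the closure of \<open>{x. x ^ n = 1}\<close> contains a nonempty open set \<open>W\<close>,
  and \<open>W\<close> contains a \<open>w\<close> with \<open>w ^ n = 1\<close>. For \<open>x\<close> near \<open>1\<close> the element \<open>w x\<close> stays in \<open>W\<close>,
  so \<open>h = (w x) ^ n\<close> lies in the closure of \<open>{1}\<close>, which forces \<open>h\<inverse>\<close> into every
  neighbourhood of \<open>1\<close>. Hence \<open>x\<inverse> = h\<inverse> (w x) ^ (n - 1) w\<close> is close to \<open>w ^ n = 1\<close>.
\<close>

context paratopological_group
begin

lemma continuous_map_mult [continuous_intros]:
  assumes "continuous_map X T f" "continuous_map X T g"
  shows "continuous_map X T (\<lambda>x. f x \<otimes> g x)"
proof -
  have "continuous_map X (prod_topology T T) (\<lambda>x. (f x, g x))"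
    using assms by (simp add: continuous_map_pairedI)
  from continuous_map_compose [OF this continuous_mult] show ?thesis
    by (simp add: o_def)
qed

lemma continuous_map_group_pow [continuous_intros]:
  assumes "continuous_map X T f"
  shows "continuous_map X T (\<lambda>x. f x [^] (n::nat))"
proof (induction n)
  case 0
  show ?case by (simp add: topspace_eq_carrier)
next
  case (Suc n)
  then show ?case using assms by (simp add: continuous_map_mult)
qed

text \<open>Only a translation is used: \<open>y \<mapsto> inv h \<otimes> y\<close> pulls
  \<open>V\<close> back to an open neighbourhood of \<open>h\<close>, which must therefore contain
  \<open>\<one>\<close>.\<close>

lemma inv_in_open_if_in_closure_of_one:
  assumes h: "h \<in> T closure_of {\<one>}" and V: "openin T V" "\<one> \<in> V"
  shows "inv h \<in> V"
proof -
  have hc: "h \<in> carrier G"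
    using h by (simp add: in_closure_of topspace_eq_carrier)
  then have "continuous_map T T (\<lambda>y. inv h \<otimes> y)"
    by (intro continuous_map_mult) (simp_all add: topspace_eq_carrier)
  then have "openin T {y \<in> topspace T. inv h \<otimes> y \<in> V}"
    using V(1) by (rule openin_continuous_map_preimage)
  moreover have "h \<in> {y \<in> topspace T. inv h \<otimes> y \<in> V}"
    using hc V(2) by (simp add: topspace_eq_carrier)
  ultimately have "\<one> \<in> {y \<in> topspace T. inv h \<otimes> y \<in> V}"
    using h unfolding in_closure_of by (metis singletonD)
  then show ?thesis using hc by simp
qed

text \<open>An open box around \<open>(\<one>, \<one>)\<close> inside the preimage of
  \<open>U\<close> is shrunk to a square by intersecting its two sides.\<close>

lemma mult_neighbourhood_of_one:
  assumes "openin T U" "\<one> \<in> U"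
  obtains V where "openin T V" "\<one> \<in> V" "\<And>x y. x \<in> V \<Longrightarrow> y \<in> V \<Longrightarrow> x \<otimes> y \<in> U"
proof -
  define P where "P = {p \<in> topspace (prod_topology T T). (\<lambda>(x, y). x \<otimes> y) p \<in> U}"
  have "openin (prod_topology T T) P"
    unfolding P_def using continuous_mult assms(1) by (rule openin_continuous_map_preimage)
  moreover have "(\<one>, \<one>) \<in> P"
    using assms(2) by (simp add: P_def topspace_eq_carrier)
  ultimately obtain A B where AB: "openin T A" "openin T B" "\<one> \<in> A" "\<one> \<in> B" "A \<times> B \<subseteq> P"
    unfolding openin_prod_topology_alt by metis
  show ?thesis
  proof (rule that)
    show "openin T (A \<inter> B)" using AB(1,2) by (rule openin_Int)
    show "\<one> \<in> A \<inter> B" using AB by simp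
    show "x \<otimes> y \<in> U" if "x \<in> A \<inter> B" "y \<in> A \<inter> B" for x y
    proof -
      have "(x, y) \<in> P" using AB(5) that by auto
      then show ?thesis by (simp add: P_def)
    qed
  qed
qed

text \<open>Translations are continuous, and
  \<open>inv y = inv (inv a \<otimes> y) \<otimes> inv a\<close> carries the condition at
  \<open>\<one>\<close> to any point \<open>a\<close>.\<close>

lemma topological_group_if_inv_continuous_at_one:
  assumes at_one: "\<And>U. \<lbrakk>openin T U; \<one> \<in> U\<rbrakk> \<Longrightarrow>
    \<exists>V. openin T V \<and> \<one> \<in> V \<and> (\<forall>x\<in>V. inv x \<in> U)"
  shows "topological_group G T"
proof unfold_locales
  show "continuous_map T T (\<lambda>x. inv x)"
    unfolding continuous_map_eq_topcontinuous_at topcontinuous_at_def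
  proof (intro ballI conjI allI impI)
    fix a U assume a: "a \<in> topspace T" and U: "openin T U \<and> inv a \<in> U"
    have ac: "a \<in> carrier G" using a by (simp add: topspace_eq_carrier)
    let ?U = "{y \<in> topspace T. y \<otimes> inv a \<in> U}"
    have "continuous_map T T (\<lambda>y. y \<otimes> inv a)"
      using ac by (intro continuous_map_mult) (simp_all add: topspace_eq_carrier)
    then have "openin T ?U"
      using U [THEN conjunct1] by (rule openin_continuous_map_preimage)
    moreover have "\<one> \<in> ?U" using U ac by (simp add: topspace_eq_carrier)
    ultimately obtain V where V: "openin T V" "\<one> \<in> V" "\<And>x. x \<in> V \<Longrightarrow> inv x \<in> ?U"
      using at_one [of ?U] by blast
    let ?W = "{y \<in> topspace T. inv a \<otimes> y \<in> V}"
    have "continuous_map T T (\<lambda>y. inv a \<otimes> y)"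
      using ac by (intro continuous_map_mult) (simp_all add: topspace_eq_carrier)
    then have "openin T ?W"
      using V(1) by (rule openin_continuous_map_preimage)
    moreover have "a \<in> ?W" using V(2) ac a by simp
    moreover have "inv y \<in> U" if "y \<in> ?W" for y
    proof -
      have yc: "y \<in> carrier G" using that by (simp add: topspace_eq_carrier)
      have "inv (inv a \<otimes> y) \<otimes> inv a \<in> U" using V(3) that by blast
      then show ?thesis using ac yc by (simp add: inv_mult_group m_assoc)
    qed
    ultimately show "\<exists>W. openin T W \<and> a \<in> W \<and> (\<forall>y\<in>W. inv y \<in> U)" by blast
  qed (auto simp: topspace_eq_carrier)
qed

lemma topological_group_if_interior_of_closure_of_torsion:
  assumes n: "0 < n"
    and int: "T interior_of (T closure_of {x \<in> carrier G. x [^] (n::nat) = \<one>}) \<noteq> {}"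
  shows "topological_group G T"
proof (rule topological_group_if_inv_continuous_at_one)
  fix U assume U: "openin T U" "\<one> \<in> U"
  define A where "A = {x \<in> carrier G. x [^] n = \<one>}"
  define W where "W = T interior_of (T closure_of A)"
  have W: "openin T W" "W \<subseteq> T closure_of A" "W \<noteq> {}"
    using int by (auto simp: W_def A_def interior_of_subset)
  then obtain v where "v \<in> W" "v \<in> T closure_of A" by blast
  \<comment> \<open>\<open>W\<close> is an open neighbourhood of a point \<open>v\<close> of the
    closure of \<open>A\<close>, so it meets \<open>A\<close> itself.\<close>
  then obtain w where "w \<in> W" "w \<in> A"
    using W(1) unfolding in_closure_of by blast
  then have w: "w \<in> W" "w \<in> carrier G" "w [^] n = \<one>"
    by (simp_all add: A_def)
  \<comment> \<open>The power map sends \<open>A\<close> into \<open>{\<one>}\<close>, hence by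
    continuity the closure of \<open>A\<close> into the closure of \<open>{\<one>}\<close>.\<close>
  have pow_W: "x [^] n \<in> T closure_of {\<one>}" if "x \<in> W" for x
  proof -
    have "continuous_map T T (\<lambda>x. x [^] n)"
      by (intro continuous_map_group_pow) simp
    from continuous_map_image_closure_subset [OF this, of A]
    have "x [^] n \<in> T closure_of ((\<lambda>x. x [^] n) ` A)"
      using that W(2) by blast
    moreover have "T closure_of ((\<lambda>x. x [^] n) ` A) \<subseteq> T closure_of {\<one>}"
      by (rule closure_of_mono) (auto simp: A_def)
    ultimately show ?thesis by blast
  qed
  from U obtain V where V: "openin T V" "\<one> \<in> V" "\<And>x y. x \<in> V \<Longrightarrow> y \<in> V \<Longrightarrow> x \<otimes> y \<in> U"
    using mult_neighbourhood_of_one by blast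
  let ?f = "\<lambda>x. w \<otimes> x" and ?g = "\<lambda>x. (w \<otimes> x) [^] (n - 1) \<otimes> w"
  \<comment> \<open>The first condition places \<open>(w \<otimes> x) [^] n\<close> in the closure
    of \<open>{\<one>}\<close>; the second controls the other factor of \<open>inv x\<close>. At
    \<open>\<one>\<close> the two maps take the values \<open>w\<close> and
    \<open>w [^] n = \<one>\<close>.\<close>
  let ?N = "{x \<in> topspace T. ?f x \<in> W} \<inter> {x \<in> topspace T. ?g x \<in> V}"
  have f: "continuous_map T T ?f" and g: "continuous_map T T ?g"
    using w(2) by (intro continuous_map_mult continuous_map_group_pow;
        simp add: topspace_eq_carrier)+
  \<comment> \<open>Here \<open>0 < n\<close> matters, since subtraction on naturals is
    truncated.\<close>
  have pow_n: "x [^] (n - 1) \<otimes> x = x [^] n" for x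
    using n nat_pow_Suc [of x "n - 1"] by simp
  have "openin T ?N"
    by (intro openin_Int openin_continuous_map_preimage [OF f W(1)]
        openin_continuous_map_preimage [OF g V(1)])
  moreover have "\<one> \<in> ?N"
    using w V(2) by (simp add: topspace_eq_carrier pow_n del: One_nat_def)
  moreover have "inv x \<in> U" if "x \<in> ?N" for x
  proof -
    have xc: "x \<in> carrier G" using that by (simp add: topspace_eq_carrier)
    let ?h = "(w \<otimes> x) [^] n"
    \<comment> \<open>Regrouping makes \<open>w \<otimes> x\<close> the last factor of the power, so
      \<open>inv ?h \<otimes> ?g x\<close> is a left inverse of \<open>x\<close>.\<close>
    have "?g x \<otimes> x = ?h"
      using w(2) xc by (simp add: m_assoc flip: pow_n)
    then have "inv ?h \<otimes> ?g x = inv x"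
      using w(2) xc by (intro inv_equality [symmetric]) (simp_all add: m_assoc)
    moreover have "inv ?h \<in> V"
      using that by (intro inv_in_open_if_in_closure_of_one V pow_W) auto
    moreover have "?g x \<in> V" using that by blast
    ultimately show ?thesis using V(3) by metis
  qed
  ultimately show "\<exists>N. openin T N \<and> \<one> \<in> N \<and> (\<forall>x\<in>N. inv x \<in> U)" by blast
qed

end

text \<open>Otherwise the complements of the closures would be countably many dense open sets with
  empty intersection, because the sets \<open>A n\<close> cover the space.\<close>

lemma Baire_space_interior_of_closure_of_nonempty:
  fixes A :: "nat \<Rightarrow> 'a set"
  assumes "Baire_space T" "topspace T \<noteq> {}" "topspace T \<subseteq> (\<Union>n. A n)"
  obtains n where "T interior_of (T closure_of (A n)) \<noteq> {}"
proof (rule ccontr)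
  assume "\<not> thesis"
  then have empty: "T interior_of (T closure_of (A n)) = {}" for n
    using that by blast
  define \<U> where "\<U> = range (\<lambda>n. topspace T - T closure_of (A n))"
  have "openin T (topspace T - T closure_of (A n))" for n
    by (simp add: openin_diff)
  moreover have "dense_in T (topspace T - T closure_of (A n))" for n
    by (simp add: dense_in_def closure_of_complement empty)
  moreover have "countable \<U>"
    by (simp add: \<U>_def)
  ultimately have "dense_in T (topspace T \<inter> \<Inter>\<U>)"
    using assms(1) unfolding Baire_space_def \<U>_def by (metis (no_types, lifting) imageE)
  moreover have "topspace T \<inter> \<Inter>\<U> = {}"
  proof -
    have "\<exists>n. x \<in> T closure_of (A n)" if x: "x \<in> topspace T" for x
    proof -
      obtain n where "x \<in> A n" using x assms(3) by blast
      then have "x \<in> T closure_of (A n)"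
        using x by (meson in_closure_of)
      then show ?thesis ..
    qed
    then show ?thesis by (auto simp: \<U>_def)
  qed
  ultimately show False
    using assms(2) by (simp add: dense_in_def)
qed

theorem proposition3p16:
  fixes G :: "('a, 'b) monoid_scheme" and T :: "'a topology"
  assumes "paratopological_group G T"
    and "Baire_space T"
    and "periodic_group G"
  shows "topological_group G T"
proof -
  interpret paratopological_group G T by fact
  \<comment> \<open>The shift by \<open>Suc\<close> keeps exponents positive; exponent 0 would give
    the whole group and no information.\<close>
  let ?A = "\<lambda>n::nat. {x \<in> carrier G. x [^]\<^bsub>G\<^esub> Suc n = \<one>\<^bsub>G\<^esub>}"
  have "x \<in> (\<Union>n. ?A n)" if x: "x \<in> topspace T" for x
  proof -
    obtain m :: nat where "0 < m" "x [^]\<^bsub>G\<^esub> m = \<one>\<^bsub>G\<^esub>"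
      using assms(3) x by (auto simp: periodic_group_def topspace_eq_carrier)
    then have "x \<in> ?A (m - 1)"
      using x by (simp add: topspace_eq_carrier del: nat_pow_Suc)
    then show ?thesis by blast
  qed
  moreover have "topspace T \<noteq> {}"
    using one_closed topspace_eq_carrier by blast
  ultimately obtain n where "T interior_of (T closure_of (?A n)) \<noteq> {}"
    using Baire_space_interior_of_closure_of_nonempty [OF assms(2), of ?A] by blast
  then show ?thesis
    by (rule topological_group_if_interior_of_closure_of_torsion [OF zero_less_Suc])
qed

end
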